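(* Let $N\ge 2$, let $\tau_1,\dots,\tau_N$ be the Legendre-Gauss-Lobatto points on $[-1,1]$ and let $\tau_{N+1}$ be a point distinct from all of $\tau_1,\dots,\tau_N$. Then $D_{(:,2:N+1)}$ is invertible and $$\left[D_{(:,2:N+1)}\right]^{-1}=B .$$ Consequently, the derivative form and the second integral form of LGL collocation are equivalent: for all $X_{1:N+1}\in\mathbb{R}^{(N+1)\times n_x}$ and $F\in\mathbb{R}^{N\times n_x}$, $$D\,X_{1:N+1}=F\quad\Longleftrightarrow\quad X_{2:N+1}=\mathbf 1X_1+BF .$$
   Context: The $N$ Legendre-Gauss-Lobatto (LGL) points $-1=\tau_1<\dots<\tau_N=1$ are the roots of $(\tau^2-1)\dot P_{N-1}(\tau)$, with $P_{N-1}$ the Legendre polynomial of degree $N-1$. $L_1,\dots,L_N$ are the Lagrange polynomials of degree $N-1$ supported at $\tau_1,\dots,\tau_N$, $L_j(\tau_i)=\delta_{ij}$. The matrix $B\in\mathbb{R}^{N\times N}$, with rows indexed by $i=2,\dots,N+1$ and columns by $j=1,\dots,N$, is $B_{ij}=\int_{-1}^{\tau_i}L_j(\tau)\,d\tau$. The matrix $D\in\mathbb{R}^{N\times(N+1)}$ is the differentiation matrix for the space of polynomials of degree at most $N$ using the $N+1$ support points $\tau_1,\dots,\tau_{N+1}$ and the $N$ collocation points $\tau_1,\dots,\tau_N$: for every polynomial $p$ of degree at most $N$, $\sum_{j=1}^{N+1}D_{ij}p(\tau_j)=\dot p(\tau_i)$ for $i=1,\dots,N$. $D_{(:,2:N+1)}$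 is the $N\times N$ matrix of columns $2$ through $N+1$ of $D$. $X_1$ is the first row of $X_{1:N+1}$, $X_{2:N+1}$ consists of the remaining rows, and $\mathbf 1$ is a column of $N$ ones. *)

theory Defs
  imports
    "HOL-Computational_Algebra.Polynomial"
    "HOL-Analysis.Interval_Integral"
    "Jordan_Normal_Form.Matrix"
begin

(* Rodrigues' formula: P_n = 1/(2^n n!) (d/dt)^n (t^2 - 1)^n. *)
definition legendre_poly :: "nat \<Rightarrow> real poly" where
  "legendre_poly n = Polynomial.smult (1 / (2 ^ n * fact n)) ((pderiv ^^ n) ([:-1, 0, 1:] ^ n))"

(* Points are indexed from 1, and only tau 1, ..., tau N are constrained. *)
definition LGL_points :: "nat \<Rightarrow> (nat \<Rightarrow> real) \<Rightarrow> bool" where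
  "LGL_points N \<tau> \<longleftrightarrow>
     \<tau> 1 = -1 \<and> \<tau> N = 1 \<and> strict_mono_on {1..N} \<tau> \<and>
     \<tau> ` {1..N} = {t. poly ([:-1, 0, 1:] * pderiv (legendre_poly (N - 1))) t = 0}"

definition lagrange_poly :: "nat \<Rightarrow> (nat \<Rightarrow> real) \<Rightarrow> nat \<Rightarrow> real poly" where
  "lagrange_poly N \<tau> j = (\<Prod>k\<in>{1..N} - {j}. Polynomial.smult (1 / (\<tau> j - \<tau> k)) [:- \<tau> k, 1:])"

(* Matrix entries are indexed from 0. Row i of B belongs to the point with number i + 2 and
   column j to the Lagrange polynomial with number j + 1. The interval integral is oriented,
   which matters for the last row when the extra point lies to the left of -1. *)
definition integration_matrix :: "nat \<Rightarrow> (nat \<Rightarrow> real) \<Rightarrow> real mat" where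
  "integration_matrix N \<tau> =
     mat N N (\<lambda>(i, j). LBINT t = ereal (-1)..ereal (\<tau> (i + 2)). poly (lagrange_poly N \<tau> (j + 1)) t)"

definition differentiation_matrix :: "nat \<Rightarrow> (nat \<Rightarrow> real) \<Rightarrow> real mat \<Rightarrow> bool" where
  "differentiation_matrix N \<tau> D \<longleftrightarrow>
     D \<in> carrier_mat N (N + 1) \<and>
     (\<forall>p :: real poly. degree p \<le> N \<longrightarrow>
        (\<forall>i\<in>{1..N}. (\<Sum>j = 1..N + 1. D $$ (i - 1, j - 1) * poly p (\<tau> j)) = poly (pderiv p) (\<tau> i)))"

definition drop_first_col :: "'a mat \<Rightarrow> 'a mat" where
  "drop_first_col A = mat (dim_row A) (dim_col A - 1) (\<lambda>(i, j). A $$ (i, j + 1))"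

definition drop_first_row :: "'a mat \<Rightarrow> 'a mat" where
  "drop_first_row A = mat (dim_row A - 1) (dim_col A) (\<lambda>(i, j). A $$ (i + 1, j))"

definition first_row :: "'a mat \<Rightarrow> 'a mat" where
  "first_row A = mat 1 (dim_col A) (\<lambda>(i, j). A $$ (0, j))"

definition ones_col :: "nat \<Rightarrow> real mat" where
  "ones_col N = mat N 1 (\<lambda>_. 1)"

end

theory Submission
  imports Defs "Jordan_Normal_Form.Determinant"
begin

text \<open>Integration and differentiation of polynomials undo each other, and both matrices are
exact on the polynomials involved. Integrating a Lagrange polynomial \<open>L\<^sub>j\<close> from
\<open>\<tau>\<^sub>1 = -1\<close> gives a polynomial of degree at most \<open>N\<close>, whose values at
\<open>\<tau>\<^sub>2, \<dots>, \<tau>\<^bsub>N+1\<^esub>\<close> form column \<open>j\<close> of \<open>B\<close>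
and whose value at \<open>\<tau>\<^sub>1\<close> is zero. Because of this zero the first column of \<open>D\<close>
does not contribute, so multiplying column \<open>j\<close> of \<open>B\<close> by the reduced differentiation
matrix returns the values of \<open>L\<^sub>j\<close> at the collocation points, which form column \<open>j\<close> of
the identity (\<open>drop_first_col_times_integration_matrix\<close>). A one-sided inverse of a square matrix
over a field is two-sided.

For the equivalence, \<open>D\<close> annihilates constants, so its first column is minus the sum of the
others, and \<open>D X\<close> is the reduced matrix applied to
\<open>X\<^bsub>2:N+1\<^esub> - \<one> X\<^sub>1\<close> (\<open>differentiation_matrix_mult_eq\<close>).
Inverting the reduced matrix then solves \<open>D X = F\<close> for
\<open>X\<^bsub>2:N+1\<^esub>\<close>.

The Legendre-Gauss-Lobatto points enter through two facts: they are distinct, and the first of them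
is the lower limit of integration.\<close>

section \<open>Antiderivatives of polynomials\<close>

lemma ex_poly_antiderivative:
  fixes p :: "'a :: field_char_0 poly"
  shows "\<exists>q. pderiv q = p \<and> degree q \<le> Suc (degree p) \<and> poly q a = 0"
proof -
  define r where "r = (\<Sum>i\<le>degree p. monom (coeff p i / of_nat (Suc i)) (Suc i))"
  have "pderiv r = (\<Sum>i\<le>degree p. monom (coeff p i) i)"
    unfolding r_def higher_pderiv_sum[of 1, simplified]
    by (intro sum.cong refl) (simp add: pderiv_monom del: of_nat_Suc)
  then have "pderiv r = p"
    by (simp add: poly_as_sum_of_monoms)
  moreover have "degree r \<le> Suc (degree p)"
    unfolding r_def
    by (intro degree_sum_le) (auto intro: order.trans[OF degree_monom_le])
  ultimately show ?thesis
    by (intro exI[of _ "r - [:poly r a:]"]) (auto simp: pderiv_diff pderiv_pCons intro!: degree_diff_le)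
qed

text \<open>No order between \<open>a\<close> and \<open>b\<close> is assumed: the last point may lie to the
left of \<open>-1\<close>, and the fundamental theorem holds for the oriented integral.\<close>

lemma interval_integral_pderiv:
  fixes p :: "real poly"
  shows "(LBINT t = ereal a..ereal b. poly (pderiv p) t) = poly p b - poly p a"
  by (intro interval_integral_FTC_finite continuous_intros)
     (auto simp: has_real_derivative_iff_has_vector_derivative[symmetric]
           intro: DERIV_subset[OF poly_DERIV])

section \<open>Lagrange polynomials\<close>

lemma degree_lagrange_poly_le:
  assumes "j \<in> {1..N}"
  shows "degree (lagrange_poly N \<tau> j) \<le> N - 1"
proof -
  have "degree (lagrange_poly N \<tau> j)
      \<le> (\<Sum>k\<in>{1..N} - {j}. degree (Polynomial.smult (1 / (\<tau> j - \<tau> k)) [:- \<tau> k, 1:]))"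
    unfolding lagrange_poly_def by (rule order.trans[OF degree_prod_sum_le]) auto
  also have "\<dots> \<le> (\<Sum>k\<in>{1..N} - {j}. 1)"
    by (intro sum_mono) (auto intro: order.trans[OF degree_smult_le])
  also have "\<dots> = N - 1"
    using assms by simp
  finally show ?thesis .
qed

lemma poly_lagrange_poly:
  assumes "inj_on \<tau> {1..N}" and "i \<in> {1..N}" and "j \<in> {1..N}"
  shows "poly (lagrange_poly N \<tau> j) (\<tau> i) = (if i = j then 1 else 0)"
proof (cases "i = j")
  case True
  have "\<tau> j - \<tau> k \<noteq> 0" if "k \<in> {1..N} - {j}" for k
    using inj_onD[OF assms(1) _ assms(3), of k] that by auto
  then have "poly (Polynomial.smult (1 / (\<tau> j - \<tau> k)) [:- \<tau> k, 1:]) (\<tau> j) = 1"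
    if "k \<in> {1..N} - {j}" for k
    using that by (simp flip: diff_divide_distrib)
  with True show ?thesis
    unfolding lagrange_poly_def poly_prod by (simp add: prod.neutral)
next
  case False
  then have "i \<in> {1..N} - {j}"
    using assms(2) by simp
  then have "poly (lagrange_poly N \<tau> j) (\<tau> i) = 0"
    unfolding lagrange_poly_def poly_prod by (intro prod_zero bexI[of _ i]) auto
  with False show ?thesis by simp
qed

section \<open>The reduced differentiation matrix\<close>

lemma differentiation_matrixD:
  assumes "differentiation_matrix N \<tau> D" and "degree p \<le> N" and "i < N"
  shows "D $$ (i, 0) * poly p (\<tau> 1) + (\<Sum>k<N. D $$ (i, k + 1) * poly p (\<tau> (k + 2)))
       = poly (pderiv p) (\<tau> (i + 1))"
proof -
  have "(\<Sum>j = 1..N + 1. D $$ (i, j - 1) * poly p (\<tau> j)) = poly (pderiv p) (\<tau> (i + 1))"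
  proof -
    have "i + 1 \<in> {1..N}"
      using assms(3) by simp
    with assms(1,2) have "(\<Sum>j = 1..N + 1. D $$ (i + 1 - 1, j - 1) * poly p (\<tau> j))
        = poly (pderiv p) (\<tau> (i + 1))"
      unfolding differentiation_matrix_def by blast
    then show ?thesis by simp
  qed
  also have "(\<Sum>j = 1..N + 1. D $$ (i, j - 1) * poly p (\<tau> j))
      = (\<Sum>k<Suc N. D $$ (i, k) * poly p (\<tau> (k + 1)))"
    by (rule sum.reindex_bij_witness[of _ Suc "\<lambda>j. j - 1"]) auto
  also have "\<dots> = D $$ (i, 0) * poly p (\<tau> 1) + (\<Sum>k<N. D $$ (i, k + 1) * poly p (\<tau> (k + 2)))"
    by (subst sum.lessThan_Suc_shift) simp
  finally show ?thesis by simp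
qed

text \<open>The derivative of the constant polynomial 1 vanishes, so each row sums to zero.\<close>

lemma differentiation_matrix_first_col:
  assumes "differentiation_matrix N \<tau> D" and "i < N"
  shows "D $$ (i, 0) = - (\<Sum>k<N. D $$ (i, k + 1))"
  using differentiation_matrixD[OF assms(1) _ assms(2), of 1] by simp

lemma differentiation_matrix_mult_eq:
  assumes D: "differentiation_matrix N \<tau> D" and X: "X \<in> carrier_mat (N + 1) nx"
  shows "D * X = drop_first_col D * (drop_first_row X - ones_col N * first_row X)"
proof (rule eq_matI)
  have dim: "D \<in> carrier_mat N (N + 1)"
    using D by (simp add: differentiation_matrix_def)
  show "dim_row (D * X) = dim_row (drop_first_col D * (drop_first_row X - ones_col N * first_row X))"
    "dim_col (D * X) = dim_col (drop_first_col D * (drop_first_row X - ones_col N * first_row X))"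
    using dim X by (auto simp: drop_first_col_def first_row_def)
  fix i c
  assume "i < dim_row (drop_first_col D * (drop_first_row X - ones_col N * first_row X))"
    and "c < dim_col (drop_first_col D * (drop_first_row X - ones_col N * first_row X))"
  then have i: "i < N" and c: "c < nx"
    using dim X by (auto simp: drop_first_col_def first_row_def)
  have "(D * X) $$ (i, c) = (\<Sum>k<Suc N. D $$ (i, k) * X $$ (k, c))"
    using dim X i c by (simp add: scalar_prod_def lessThan_atLeast0)
  also have "\<dots> = D $$ (i, 0) * X $$ (0, c) + (\<Sum>k<N. D $$ (i, k + 1) * X $$ (k + 1, c))"
    by (subst sum.lessThan_Suc_shift) simp
  also have "\<dots> = (\<Sum>k<N. D $$ (i, k + 1) * (X $$ (k + 1, c) - X $$ (0, c)))"
    by (simp add: differentiation_matrix_first_col[OF D i] right_diff_distrib sum_subtractf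
        sum_distrib_right)
  also have "\<dots> = (drop_first_col D * (drop_first_row X - ones_col N * first_row X)) $$ (i, c)"
    using dim X i c
    by (simp add: scalar_prod_def lessThan_atLeast0 drop_first_col_def drop_first_row_def
        first_row_def ones_col_def)
  finally show "(D * X) $$ (i, c)
      = (drop_first_col D * (drop_first_row X - ones_col N * first_row X)) $$ (i, c)" .
qed

text \<open>Column \<open>j\<close> of the integration matrix samples the antiderivative \<open>q\<close> of a
Lagrange polynomial that vanishes at \<open>-1\<close>. Since \<open>q\<close> has degree at most \<open>N\<close>,
it is differentiated exactly, and its zero at the first point is what allows the first column of
\<open>D\<close> to be dropped.\<close>

lemma drop_first_col_times_integration_matrix:
  assumes D: "differentiation_matrix N \<tau> D" and inj: "inj_on \<tau> {1..N}" and \<tau>1: "\<tau> 1 = -1"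
  shows "drop_first_col D * integration_matrix N \<tau> = 1\<^sub>m N"
proof (rule eq_matI)
  have dim: "D \<in> carrier_mat N (N + 1)"
    using D by (simp add: differentiation_matrix_def)
  show "dim_row (drop_first_col D * integration_matrix N \<tau>) = dim_row (1\<^sub>m N)"
    "dim_col (drop_first_col D * integration_matrix N \<tau>) = dim_col (1\<^sub>m N)"
    using dim by (auto simp: drop_first_col_def integration_matrix_def)
  fix i j :: nat
  assume "i < dim_row (1\<^sub>m N)" and "j < dim_col (1\<^sub>m N)"
  then have i: "i < N" and j: "j < N"
    by auto
  obtain q where q: "pderiv q = lagrange_poly N \<tau> (j + 1)"
      "degree q \<le> Suc (degree (lagrange_poly N \<tau> (j + 1)))" "poly q (-1) = 0"
    using ex_poly_antiderivative[of "lagrange_poly N \<tau> (j + 1)" "-1"] by blast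
  have deg: "degree q \<le> N"
    using q(2) degree_lagrange_poly_le[of "j + 1" N \<tau>] j by auto
  have B: "integration_matrix N \<tau> $$ (k, j) = poly q (\<tau> (k + 2))" if "k < N" for k
    using that j q(3) interval_integral_pderiv[of "-1" "\<tau> (k + 2)" q]
    by (simp add: integration_matrix_def q(1))
  have "(drop_first_col D * integration_matrix N \<tau>) $$ (i, j)
      = (\<Sum>k<N. D $$ (i, k + 1) * integration_matrix N \<tau> $$ (k, j))"
    using dim i j
    by (simp add: scalar_prod_def lessThan_atLeast0 drop_first_col_def integration_matrix_def)
  also have "\<dots> = D $$ (i, 0) * poly q (\<tau> 1) + (\<Sum>k<N. D $$ (i, k + 1) * poly q (\<tau> (k + 2)))"
    using B q(3) \<tau>1 by simp
  also have "\<dots> = poly (lagrange_poly N \<tau> (j + 1)) (\<tau> (i + 1))"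
    using differentiation_matrixD[OF D deg i] q(1) by simp
  also have "\<dots> = 1\<^sub>m N $$ (i, j)"
    using poly_lagrange_poly[OF inj, of "i + 1" "j + 1"] i j by simp
  finally show "(drop_first_col D * integration_matrix N \<tau>) $$ (i, j) = 1\<^sub>m N $$ (i, j)" .
qed

section \<open>Equivalence of the derivative and integral forms\<close>

lemma mult_eq_iff_eq_inverse_mult:
  fixes A B :: "'a :: comm_ring_1 mat"
  assumes A: "A \<in> carrier_mat n n" and B: "B \<in> carrier_mat n n"
    and AB: "A * B = 1\<^sub>m n" and BA: "B * A = 1\<^sub>m n"
    and Y: "Y \<in> carrier_mat n m" and F: "F \<in> carrier_mat n m"
  shows "A * Y = F \<longleftrightarrow> Y = B * F"
proof
  assume "A * Y = F"
  then have "B * F = B * A * Y"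
    using A B Y by simp
  then show "Y = B * F"
    using BA Y by simp
next
  assume "Y = B * F"
  then have "A * Y = A * B * F"
    using A B F by simp
  then show "A * Y = F"
    using AB F by simp
qed

lemma minus_mat_eq_iff_eq_plus:
  fixes P Q R :: "'a :: ab_group_add mat"
  assumes "P \<in> carrier_mat n m" and "Q \<in> carrier_mat n m" and "R \<in> carrier_mat n m"
  shows "P - Q = R \<longleftrightarrow> P = Q + R"
proof
  assume "P - Q = R"
  then show "P = Q + R"
    using assms by (intro eq_matI) auto
next
  assume "P = Q + R"
  then show "P - Q = R"
    using assms by (intro eq_matI) auto
qed

theorem mainTheorem3:
  fixes N :: nat and \<tau> :: "nat \<Rightarrow> real" and D :: "real mat"
  assumes "N \<ge> 2"
    and "LGL_points N \<tau>"
    and "\<forall>i\<in>{1..N}. \<tau> (N + 1) \<noteq> \<tau> i"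
    and "differentiation_matrix N \<tau> D"
  shows "invertible_mat (drop_first_col D)
       \<and> inverts_mat (drop_first_col D) (integration_matrix N \<tau>)
       \<and> inverts_mat (integration_matrix N \<tau>) (drop_first_col D)
       \<and> (\<forall>nx. \<forall>X \<in> carrier_mat (N + 1) nx. \<forall>F \<in> carrier_mat N nx.
            D * X = F \<longleftrightarrow>
            drop_first_row X = ones_col N * first_row X + integration_matrix N \<tau> * F)"
proof -
  let ?A = "drop_first_col D" and ?B = "integration_matrix N \<tau>"
  have \<tau>1: "\<tau> 1 = -1" and inj: "inj_on \<tau> {1..N}"
    using assms(2) by (auto simp: LGL_points_def intro: strict_mono_on_imp_inj_on)
  have A: "?A \<in> carrier_mat N N" and B: "?B \<in> carrier_mat N N"
    using assms(4)
    by (auto simp: differentiation_matrix_def drop_first_col_def integration_matrix_def)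
  have AB: "?A * ?B = 1\<^sub>m N"
    using assms(4) inj \<tau>1 by (rule drop_first_col_times_integration_matrix)
  have BA: "?B * ?A = 1\<^sub>m N"
    using mat_mult_left_right_inverse[OF A B AB] .
  have inv: "inverts_mat ?A ?B" "inverts_mat ?B ?A"
    using A B AB BA by (auto simp: inverts_mat_def)
  have equiv: "D * X = F \<longleftrightarrow> drop_first_row X = ones_col N * first_row X + ?B * F"
    if X: "X \<in> carrier_mat (N + 1) nx" and F: "F \<in> carrier_mat N nx" for nx X F
  proof -
    have P: "drop_first_row X \<in> carrier_mat N nx" and Q: "ones_col N * first_row X \<in> carrier_mat N nx"
      using X by (auto simp: drop_first_row_def ones_col_def first_row_def)
    have "D * X = F \<longleftrightarrow> ?A * (drop_first_row X - ones_col N * first_row X) = F"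
      by (simp add: differentiation_matrix_mult_eq[OF assms(4) X])
    also have "\<dots> \<longleftrightarrow> drop_first_row X - ones_col N * first_row X = ?B * F"
      using A B AB BA minus_carrier_mat[OF Q] F by (rule mult_eq_iff_eq_inverse_mult)
    also have "\<dots> \<longleftrightarrow> drop_first_row X = ones_col N * first_row X + ?B * F"
      using P Q mult_carrier_mat[OF B F] by (rule minus_mat_eq_iff_eq_plus)
    finally show ?thesis .
  qed
  have "invertible_mat ?A"
    using A inv by (auto simp: invertible_mat_def)
  with inv equiv show ?thesis
    by blast
qed

end
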